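(* Let $G$ be a topological group, let $p\colon E\to B$ be a $G$-fibration and let $B'$ be a $G$-invariant subset of $B$. If $E'=p^{-1}(B')$ and $p'\colon E'\to B'$ is the $G$-fibration obtained by restriction of $p$, then $$\mathrm{TC}^{G}[p'\colon E'\to B']\le\mathrm{TC}^{G}[p\colon E\to B].$$ In particular, if $b\in B^G$ (i.e. $b$ is fixed by $G$), then the fibre $F=p^{-1}(b)$ is a $G$-space and $$\mathrm{TC}^{G}(F)\le\mathrm{TC}^{G}[p\colon E\to B].$$
   Context: All spaces are Hausdorff, $I=[0,1]$, path spaces carry the compact-open topology. A $G$-map is a continuous equivariant map; a $G$-homotopy is an equivariant homotopy ($G$ acting trivially on $I$). A $G$-fibration is a $G$-map with the $G$-homotopy lifting property with respect to every $G$-space. Equivariant sectional category: for a $G$-map $q\colon X\to Y$, $\mathrm{secat}_G(q)$ is the least positive integer $k$ such that $Y$ has a cover by $G$-invariant open sets $U_1,\dots,U_k$ with $G$-maps $s_i\colon U_i\to X$ such that $q\circ s_i$ is $G$-homotopic to the inclusion $U_i\hookrightarrow Y$ ($\infty$ if there is no such $k$). Invariant parametrized topological complexity: for a $G$-fibration $p\colon E\to B$, let $E^I_B$ be the space of paths $\gamma\colon I\to E$ whose image lies in a single fibre of $p$, with $(g\cdot\gamma)(t)=g\cdot\gamma(t)$. Put $E^I_B\times_{E/G}E^I_B=\{(\gamma,\delta)\in E^I_B\times E^I_B : G\cdot\gamma(1)=G\cdot\delta(0)\}$ and $E\times_{B/G}E=\{(e_1,e_2)\in E\times E : G\cdot p(e_1)=G\cdot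 p(e_2)\}$, with the componentwise $(G\times G)$-actions, and let $\Psi(\gamma,\delta)=(\gamma(0),\delta(1))$, a $(G\times G)$-fibration $E^I_B\times_{E/G}E^I_B\to E\times_{B/G}E$. Then $\mathrm{TC}^G[p\colon E\to B]:=\mathrm{secat}_{G\times G}(\Psi)$. Invariant topological complexity: for a $G$-space $X$ with free path space $PX=X^I$, let $PX\times_{X/G}PX=\{(\gamma,\delta)\in PX\times PX: G\cdot\gamma(1)=G\cdot\delta(0)\}$ and $\mathfrak{p}(\gamma,\delta)=(\gamma(0),\delta(1))$, a $(G\times G)$-fibration $PX\times_{X/G}PX\to X\times X$; $\mathrm{TC}^G(X):=\mathrm{secat}_{G\times G}(\mathfrak{p})$.
   Formalization: The formal theorem assumes explicitly that the map Ψ defining TC^G[p: E→B] is a (G×G)-fibration; this does not hold for every G-fibration p, and without it the first inequality can fail. *)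

theory Defs
  imports "HOL-Analysis.Analysis" "HOL-Algebra.Group_Action" "HOL-Library.Extended_Nat"
begin

section \<open>G-spaces, G-maps and G-homotopies\<close>

definition topological_group :: "'g monoid \<Rightarrow> 'g topology \<Rightarrow> bool" where
  "topological_group G T \<longleftrightarrow>
     group G \<and> topspace T = carrier G \<and> Hausdorff_space T \<and>
     continuous_map (prod_topology T T) T (\<lambda>(g, h). g \<otimes>\<^bsub>G\<^esub> h) \<and>
     continuous_map T T (\<lambda>g. inv\<^bsub>G\<^esub> g)"

text \<open>An action is a function \<open>\<phi>\<close> of which only the values \<open>\<phi> g x\<close> with \<open>g \<in> carrier G\<close> and
  \<open>x \<in> topspace X\<close> matter. Unlike in \<^locale>\<open>group_action\<close>, \<open>\<phi> g\<close> is not required to be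
  \<open>undefined\<close> off the space, so the action induced on an invariant subspace is \<open>\<phi>\<close> itself.
  Continuity includes that \<open>\<phi> g x\<close> lies in \<open>X\<close>.\<close>

definition G_space :: "'g monoid \<Rightarrow> 'g topology \<Rightarrow> 'x topology \<Rightarrow> ('g \<Rightarrow> 'x \<Rightarrow> 'x) \<Rightarrow> bool" where
  "G_space G T X \<phi> \<longleftrightarrow>
     Hausdorff_space X \<and>
     continuous_map (prod_topology T X) X (\<lambda>(g, x). \<phi> g x) \<and>
     (\<forall>x\<in>topspace X. \<phi> \<one>\<^bsub>G\<^esub> x = x) \<and>
     (\<forall>g\<in>carrier G. \<forall>h\<in>carrier G. \<forall>x\<in>topspace X. \<phi> (g \<otimes>\<^bsub>G\<^esub> h) x = \<phi> g (\<phi> h x))"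

definition invariant_set :: "'g monoid \<Rightarrow> ('g \<Rightarrow> 'x \<Rightarrow> 'x) \<Rightarrow> 'x set \<Rightarrow> bool" where
  "invariant_set G \<phi> S \<longleftrightarrow> (\<forall>g\<in>carrier G. \<forall>x\<in>S. \<phi> g x \<in> S)"

definition equivariant ::
  "'g monoid \<Rightarrow> 'x topology \<Rightarrow> ('g \<Rightarrow> 'x \<Rightarrow> 'x) \<Rightarrow> ('g \<Rightarrow> 'y \<Rightarrow> 'y) \<Rightarrow> ('x \<Rightarrow> 'y) \<Rightarrow> bool" where
  "equivariant G X \<phi> \<psi> f \<longleftrightarrow> (\<forall>g\<in>carrier G. \<forall>x\<in>topspace X. f (\<phi> g x) = \<psi> g (f x))"

definition G_map ::
  "'g monoid \<Rightarrow> 'x topology \<Rightarrow> ('g \<Rightarrow> 'x \<Rightarrow> 'x) \<Rightarrow> 'y topology \<Rightarrow> ('g \<Rightarrow> 'y \<Rightarrow> 'y) \<Rightarrow> ('x \<Rightarrow> 'y) \<Rightarrow> bool" where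
  "G_map G X \<phi> Y \<psi> f \<longleftrightarrow> continuous_map X Y f \<and> equivariant G X \<phi> \<psi> f"

abbreviation unit_interval :: "real topology" where
  "unit_interval \<equiv> top_of_set {0..1}"

text \<open>As \<open>G\<close> acts trivially on the interval, a homotopy is equivariant iff each of its stages is.\<close>

definition G_homotopy ::
  "'g monoid \<Rightarrow> 'x topology \<Rightarrow> ('g \<Rightarrow> 'x \<Rightarrow> 'x) \<Rightarrow> 'y topology \<Rightarrow> ('g \<Rightarrow> 'y \<Rightarrow> 'y) \<Rightarrow> (real \<times> 'x \<Rightarrow> 'y) \<Rightarrow> bool" where
  "G_homotopy G X \<phi> Y \<psi> h \<longleftrightarrow>
     continuous_map (prod_topology unit_interval X) Y h \<and>
     (\<forall>t\<in>{0..1}. equivariant G X \<phi> \<psi> (\<lambda>x. h (t, x)))"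

definition G_homotopic ::
  "'g monoid \<Rightarrow> 'x topology \<Rightarrow> ('g \<Rightarrow> 'x \<Rightarrow> 'x) \<Rightarrow> 'y topology \<Rightarrow> ('g \<Rightarrow> 'y \<Rightarrow> 'y) \<Rightarrow> ('x \<Rightarrow> 'y) \<Rightarrow> ('x \<Rightarrow> 'y) \<Rightarrow> bool" where
  "G_homotopic G X \<phi> Y \<psi> f f' \<longleftrightarrow> homotopic_with (equivariant G X \<phi> \<psi>) X Y f f'"


section \<open>G-fibrations\<close>

text \<open>The G-homotopy lifting property of \<open>p\<close> with respect to all G-spaces whose points form
  a subset of the type \<open>'x\<close>.\<close>

definition G_HLP ::
  "'x itself \<Rightarrow> 'g monoid \<Rightarrow> 'g topology \<Rightarrow> 'e topology \<Rightarrow> ('g \<Rightarrow> 'e \<Rightarrow> 'e) \<Rightarrow>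
   'b topology \<Rightarrow> ('g \<Rightarrow> 'b \<Rightarrow> 'b) \<Rightarrow> ('e \<Rightarrow> 'b) \<Rightarrow> bool" where
  "G_HLP ty G T E \<phi> B \<psi> p \<longleftrightarrow>
     (\<forall>(X :: 'x topology) \<xi> f h.
        G_space G T X \<xi> \<and> G_map G X \<xi> E \<phi> f \<and> G_homotopy G X \<xi> B \<psi> h \<and>
        (\<forall>x\<in>topspace X. h (0, x) = p (f x)) \<longrightarrow>
        (\<exists>k. G_homotopy G X \<xi> E \<phi> k \<and>
             (\<forall>x\<in>topspace X. k (0, x) = f x) \<and>
             (\<forall>t\<in>{0..1}. \<forall>x\<in>topspace X. p (k (t, x)) = h (t, x))))"

text \<open>A G-fibration has the lifting property for every G-space, but a definition in HOL cannot
  quantify over types. It suffices to test on the type \<open>'e \<times> (real \<Rightarrow> 'b)\<close>, since that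
  type contains the mapping path space \<open>{(e, \<beta>). p e = \<beta> 0}\<close>, the universal test space.
  Lemma \<open>G_fibration_imp_G_HLP\<close> below derives the lifting property for test spaces
  over an arbitrary type.\<close>

definition G_fibration ::
  "'g monoid \<Rightarrow> 'g topology \<Rightarrow> 'e topology \<Rightarrow> ('g \<Rightarrow> 'e \<Rightarrow> 'e) \<Rightarrow>
   'b topology \<Rightarrow> ('g \<Rightarrow> 'b \<Rightarrow> 'b) \<Rightarrow> ('e \<Rightarrow> 'b) \<Rightarrow> bool" where
  "G_fibration G T E \<phi> B \<psi> p \<longleftrightarrow>
     G_space G T E \<phi> \<and> G_space G T B \<psi> \<and> G_map G E \<phi> B \<psi> p \<and>
     G_HLP TYPE('e \<times> (real \<Rightarrow> 'b)) G T E \<phi> B \<psi> p"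


section \<open>Path spaces\<close>

text \<open>Continuous maps are represented by functions that are \<open>undefined\<close> off the domain.\<close>

definition compact_open_topology :: "'a topology \<Rightarrow> 'b topology \<Rightarrow> ('a \<Rightarrow> 'b) topology" where
  "compact_open_topology X Y =
     topology_generated_by
       {{f \<in> extensional (topspace X). continuous_map X Y f \<and> f ` K \<subseteq> U} | K U.
          compactin X K \<and> openin Y U}"

definition path_space :: "'a topology \<Rightarrow> (real \<Rightarrow> 'a) topology" where
  "path_space X = compact_open_topology unit_interval X"

definition path_action :: "('g \<Rightarrow> 'a \<Rightarrow> 'a) \<Rightarrow> 'g \<Rightarrow> (real \<Rightarrow> 'a) \<Rightarrow> (real \<Rightarrow> 'a)" where
  "path_action \<phi> g \<gamma> = (\<lambda>t\<in>{0..1}. \<phi> g (\<gamma> t))"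

definition fibre_path_space :: "'e topology \<Rightarrow> 'b topology \<Rightarrow> ('e \<Rightarrow> 'b) \<Rightarrow> (real \<Rightarrow> 'e) topology" where
  "fibre_path_space E B p =
     subtopology (path_space E) {\<gamma>. \<exists>b\<in>topspace B. \<forall>t\<in>{0..1}. p (\<gamma> t) = b}"


section \<open>Equivariant sectional category and the two invariant topological complexities\<close>

text \<open>The infimum of the empty set in \<^typ>\<open>enat\<close> is \<open>\<infinity>\<close>.\<close>

definition secat_G ::
  "'g monoid \<Rightarrow> 'x topology \<Rightarrow> ('g \<Rightarrow> 'x \<Rightarrow> 'x) \<Rightarrow> 'y topology \<Rightarrow> ('g \<Rightarrow> 'y \<Rightarrow> 'y) \<Rightarrow> ('x \<Rightarrow> 'y) \<Rightarrow> enat" where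
  "secat_G G X \<phi> Y \<psi> q =
     Inf {enat k | k. k \<ge> 1 \<and>
       (\<exists>U :: nat \<Rightarrow> 'y set.
          (\<Union>i<k. U i) = topspace Y \<and>
          (\<forall>i<k. openin Y (U i) \<and> invariant_set G \<psi> (U i) \<and>
             (\<exists>s. G_map G (subtopology Y (U i)) \<psi> X \<phi> s \<and>
                  G_homotopic G (subtopology Y (U i)) \<psi> Y \<psi> (\<lambda>y. q (s y)) (\<lambda>y. y))))}"

definition prod_action :: "('g \<Rightarrow> 'a \<Rightarrow> 'a) \<Rightarrow> ('h \<Rightarrow> 'b \<Rightarrow> 'b) \<Rightarrow> 'g \<times> 'h \<Rightarrow> 'a \<times> 'b \<Rightarrow> 'a \<times> 'b" where
  "prod_action \<phi> \<psi> = (\<lambda>(g, h) (x, y). (\<phi> g x, \<psi> h y))"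

text \<open>Given a space \<open>P\<close> of paths in a G-space, the space of pairs \<open>(\<gamma>, \<delta>)\<close> of paths in \<open>P\<close>
  with \<open>G \<sqdot> \<gamma>(1) = G \<sqdot> \<delta>(0)\<close>.\<close>

definition orbit_joined_pairs ::
  "'g monoid \<Rightarrow> ('g \<Rightarrow> 'a \<Rightarrow> 'a) \<Rightarrow> (real \<Rightarrow> 'a) topology \<Rightarrow> ((real \<Rightarrow> 'a) \<times> (real \<Rightarrow> 'a)) topology" where
  "orbit_joined_pairs G \<phi> P =
     subtopology (prod_topology P P) {(\<gamma>, \<delta>). orbit G \<phi> (\<gamma> 1) = orbit G \<phi> (\<delta> 0)}"

definition same_base_orbit ::
  "'g monoid \<Rightarrow> 'e topology \<Rightarrow> ('g \<Rightarrow> 'b \<Rightarrow> 'b) \<Rightarrow> ('e \<Rightarrow> 'b) \<Rightarrow> ('e \<times> 'e) topology" where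
  "same_base_orbit G E \<psi> p =
     subtopology (prod_topology E E) {(e1, e2). orbit G \<psi> (p e1) = orbit G \<psi> (p e2)}"

definition outer_endpoints :: "(real \<Rightarrow> 'a) \<times> (real \<Rightarrow> 'a) \<Rightarrow> 'a \<times> 'a" where
  "outer_endpoints = (\<lambda>(\<gamma>, \<delta>). (\<gamma> 0, \<delta> 1))"

text \<open>\<open>TC\<^sup>G[p: E \<rightarrow> B]\<close>\<close>

definition inv_param_TC ::
  "'g monoid \<Rightarrow> 'e topology \<Rightarrow> ('g \<Rightarrow> 'e \<Rightarrow> 'e) \<Rightarrow> 'b topology \<Rightarrow> ('g \<Rightarrow> 'b \<Rightarrow> 'b) \<Rightarrow> ('e \<Rightarrow> 'b) \<Rightarrow> enat" where
  "inv_param_TC G E \<phi> B \<psi> p =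
     secat_G (G \<times>\<times> G)
       (orbit_joined_pairs G \<phi> (fibre_path_space E B p)) (prod_action (path_action \<phi>) (path_action \<phi>))
       (same_base_orbit G E \<psi> p) (prod_action \<phi> \<phi>)
       outer_endpoints"

text \<open>\<open>TC\<^sup>G(X)\<close>\<close>

definition inv_TC :: "'g monoid \<Rightarrow> 'x topology \<Rightarrow> ('g \<Rightarrow> 'x \<Rightarrow> 'x) \<Rightarrow> enat" where
  "inv_TC G X \<phi> =
     secat_G (G \<times>\<times> G)
       (orbit_joined_pairs G \<phi> (path_space X)) (prod_action (path_action \<phi>) (path_action \<phi>))
       (prod_topology X X) (prod_action \<phi> \<phi>)
       outer_endpoints"

text \<open>\<open>\<Psi>\<close> is a \<open>(G \<times> G)\<close>-fibration. This is not automatic. Let \<open>G = {1, -1}\<close> act on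
  \<open>B = [-1, 1]\<close> by multiplication and on \<open>E = [-1, 1] \<times> {1, -1}\<close> diagonally. The projection is a
  G-fibration. The path \<open>((\<bar>1 - 2t\<bar>, 1), (1 - 2t, 1))\<close> in \<open>E \<times>\<^bsub>B/G\<^esub> E\<close> starts in the
  image of \<open>\<Psi>\<close> but ends outside it.\<close>

definition Psi_is_fibration ::
  "'g monoid \<Rightarrow> 'g topology \<Rightarrow> 'e topology \<Rightarrow> ('g \<Rightarrow> 'e \<Rightarrow> 'e) \<Rightarrow>
   'b topology \<Rightarrow> ('g \<Rightarrow> 'b \<Rightarrow> 'b) \<Rightarrow> ('e \<Rightarrow> 'b) \<Rightarrow> bool" where
  "Psi_is_fibration G T E \<phi> B \<psi> p \<longleftrightarrow>
     G_fibration (G \<times>\<times> G) (prod_topology T T)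
       (orbit_joined_pairs G \<phi> (fibre_path_space E B p)) (prod_action (path_action \<phi>) (path_action \<phi>))
       (same_base_orbit G E \<psi> p) (prod_action \<phi> \<phi>)
       outer_endpoints"


section \<open>The mapping path space is a universal test space\<close>

lemma topspace_compact_open:
  "topspace (compact_open_topology X Y) = {f \<in> extensional (topspace X). continuous_map X Y f}"
  unfolding compact_open_topology_def topology_generated_by_topspace
proof (intro equalityI subsetI)
  fix f assume "f \<in> {f \<in> extensional (topspace X). continuous_map X Y f}"
  then show "f \<in> \<Union> {{f \<in> extensional (topspace X). continuous_map X Y f \<and> f ` K \<subseteq> U} | K U.
          compactin X K \<and> openin Y U}"
    by (intro UnionI[where X = "{f \<in> extensional (topspace X). continuous_map X Y f \<and> f ` {} \<subseteq> {}}"])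
      (auto intro!: exI[where x = "{}"])
qed auto

lemma openin_compact_open_subbasic:
  assumes "compactin X K" "openin Y U"
  shows "openin (compact_open_topology X Y)
           {f \<in> extensional (topspace X). continuous_map X Y f \<and> f ` K \<subseteq> U}"
  unfolding compact_open_topology_def
  by (rule topology_generated_by_Basis) (use assms in blast)

lemma Hausdorff_compact_open:
  assumes "Hausdorff_space Y"
  shows "Hausdorff_space (compact_open_topology X Y)"
  unfolding Hausdorff_space_def
proof (intro allI impI)
  fix f g
  assume "f \<in> topspace (compact_open_topology X Y) \<and> g \<in> topspace (compact_open_topology X Y) \<and> f \<noteq> g"
  then have f: "f \<in> extensional (topspace X)" "continuous_map X Y f"
    and g: "g \<in> extensional (topspace X)" "continuous_map X Y g" and "f \<noteq> g"
    by (auto simp: topspace_compact_open)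
  then obtain x where x: "x \<in> topspace X" "f x \<noteq> g x"
    by (meson extensionalityI)
  then have "f x \<in> topspace Y" "g x \<in> topspace Y"
    using f g by (auto simp: continuous_map_def)
  then obtain U V where UV: "openin Y U" "openin Y V" "f x \<in> U" "g x \<in> V" "disjnt U V"
    using assms x(2) unfolding Hausdorff_space_def by blast
  let ?N = "\<lambda>U. {f \<in> extensional (topspace X). continuous_map X Y f \<and> f ` {x} \<subseteq> U}"
  have "compactin X {x}" using x by simp
  then have "openin (compact_open_topology X Y) (?N U)" "openin (compact_open_topology X Y) (?N V)"
    by (rule openin_compact_open_subbasic; use UV in simp)+
  moreover have "f \<in> ?N U" "g \<in> ?N V" "disjnt (?N U) (?N V)"
    using f g UV by (auto simp: disjnt_def)
  ultimately show "\<exists>U V. openin (compact_open_topology X Y) U \<and> openin (compact_open_topology X Y) V \<and>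
      f \<in> U \<and> g \<in> V \<and> disjnt U V"
    by blast
qed

lemma continuous_map_curry:
  assumes F: "continuous_map (prod_topology Z X) Y F"
  shows "continuous_map Z (compact_open_topology X Y) (\<lambda>z. \<lambda>x\<in>topspace X. F (z, x))"
proof -
  have c: "continuous_map X Y (\<lambda>x\<in>topspace X. F (z, x))" if "z \<in> topspace Z" for z
  proof -
    have "continuous_map X (prod_topology Z X) (\<lambda>x. (z, x))"
      using that by (intro continuous_intros) auto
    then have "continuous_map X Y (\<lambda>x. F (z, x))"
      using continuous_map_compose[OF _ F] by (simp add: o_def)
    then show ?thesis by (rule continuous_map_eq) simp
  qed
  have o: "openin Z ({z. (\<lambda>x\<in>topspace X. F (z, x)) ` K \<subseteq> U} \<inter> topspace Z)"
    if K: "compactin X K" and U: "openin Y U" for K U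
  proof (subst openin_subopen, intro ballI)
    fix z assume z: "z \<in> {z. (\<lambda>x\<in>topspace X. F (z, x)) ` K \<subseteq> U} \<inter> topspace Z"
    have KX: "K \<subseteq> topspace X" using K by (rule compactin_subset_topspace)
    let ?W = "{w \<in> topspace (prod_topology Z X). F w \<in> U}"
    have W: "openin (prod_topology Z X) ?W"
      using F U by (rule openin_continuous_map_preimage)
    have "{z} \<times> K \<subseteq> ?W" using z KX by auto
    moreover have "compactin Z {z}" using z by simp
    ultimately obtain A C where A: "openin Z A" "openin X C" "{z} \<subseteq> A" "K \<subseteq> C" "A \<times> C \<subseteq> ?W"
      using Wallace_theorem_prod_topology[of Z "{z}" X K, OF _ K W] that by (smt (verit))
    then have "A \<subseteq> {z. (\<lambda>x\<in>topspace X. F (z, x)) ` K \<subseteq> U} \<inter> topspace Z"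
      using KX openin_subset[OF A(1)] by auto
    then show "\<exists>T. openin Z T \<and> z \<in> T \<and> T \<subseteq> {z. (\<lambda>x\<in>topspace X. F (z, x)) ` K \<subseteq> U} \<inter> topspace Z"
      using A by blast
  qed
  show ?thesis
    unfolding compact_open_topology_def
  proof (subst continuous_on_generated_topo_iff, intro conjI allI impI)
    fix S
    assume "S \<in> {{f \<in> extensional (topspace X). continuous_map X Y f \<and> f ` K \<subseteq> U} | K U.
          compactin X K \<and> openin Y U}"
    then obtain K U where S: "S = {f \<in> extensional (topspace X). continuous_map X Y f \<and> f ` K \<subseteq> U}"
      and "compactin X K" "openin Y U"
      by blast
    moreover have "(\<lambda>z. \<lambda>x\<in>topspace X. F (z, x)) -` S \<inter> topspace Z =
        {z. (\<lambda>x\<in>topspace X. F (z, x)) ` K \<subseteq> U} \<inter> topspace Z"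
      unfolding S using c by auto
    ultimately show "openin Z ((\<lambda>z. \<lambda>x\<in>topspace X. F (z, x)) -` S \<inter> topspace Z)"
      using o by simp
  next
    have "(\<lambda>z. \<lambda>x\<in>topspace X. F (z, x)) ` topspace Z \<subseteq> topspace (compact_open_topology X Y)"
      unfolding topspace_compact_open using c by auto
    then show "(\<lambda>z. \<lambda>x\<in>topspace X. F (z, x)) ` topspace Z \<subseteq>
      \<Union> {{f \<in> extensional (topspace X). continuous_map X Y f \<and> f ` K \<subseteq> U} | K U.
          compactin X K \<and> openin Y U}"
      by (simp only: compact_open_topology_def topology_generated_by_topspace)
  qed
qed

lemma topspace_path_space:
  "topspace (path_space X) = {\<gamma> \<in> extensional {0..1}. continuous_map unit_interval X \<gamma>}"
  by (simp add: path_space_def topspace_compact_open)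

lemma path_space_at:
  assumes "\<gamma> \<in> topspace (path_space X)" "t \<in> {0..1}"
  shows "\<gamma> t \<in> topspace X"
  using assms by (auto simp: topspace_path_space continuous_map_def)

lemma continuous_map_path_curry:
  assumes "continuous_map (prod_topology Z unit_interval) Y F"
  shows "continuous_map Z (path_space Y) (\<lambda>z. \<lambda>t\<in>{0..1}. F (z, t))"
  using continuous_map_curry[OF assms] by (simp add: path_space_def)

lemma continuous_map_path_eval:
  "continuous_map (prod_topology (path_space X) unit_interval) X (\<lambda>(\<gamma>, t). \<gamma> t)"
  unfolding continuous_map_def
proof (intro conjI allI impI)
  show "(\<lambda>(\<gamma>, t). \<gamma> t) \<in> topspace (prod_topology (path_space X) unit_interval) \<rightarrow> topspace X"
    by (auto intro!: path_space_at)
  fix U assume U: "openin X U"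
  let ?S = "{w \<in> topspace (prod_topology (path_space X) unit_interval). (\<lambda>(\<gamma>, t). \<gamma> t) w \<in> U}"
  show "openin (prod_topology (path_space X) unit_interval) ?S"
  proof (subst openin_subopen, intro ballI)
    fix w assume "w \<in> ?S"
    then obtain \<gamma> t where w: "w = (\<gamma>, t)" and \<gamma>: "\<gamma> \<in> topspace (path_space X)"
      and t: "t \<in> {0..1}" and "\<gamma> t \<in> U"
      by (cases w) auto
    have "openin unit_interval {t \<in> topspace unit_interval. \<gamma> t \<in> U}"
      using \<gamma> U by (intro openin_continuous_map_preimage) (auto simp: topspace_path_space)
    then obtain e where e: "e > 0" "\<And>s. s \<in> {0..1} \<Longrightarrow> dist s t < e \<Longrightarrow> \<gamma> s \<in> U"
      using \<open>\<gamma> t \<in> U\<close> t unfolding openin_euclidean_subtopology_iff by auto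
    define K where "K = {0..1} \<inter> cball t (e/2)"
    have K: "compactin unit_interval K"
      by (auto simp: K_def compactin_subtopology intro: compact_Int)
    have "\<gamma> ` K \<subseteq> U"
      using e by (auto simp: K_def dist_commute)
    let ?N = "{f \<in> extensional (topspace unit_interval). continuous_map unit_interval X f \<and> f ` K \<subseteq> U}"
    have "openin (path_space X) ?N"
      unfolding path_space_def using K U by (rule openin_compact_open_subbasic)
    moreover have V: "openin unit_interval ({0..1} \<inter> ball t (e/2))"
      by (simp add: openin_open_Int)
    ultimately have "openin (prod_topology (path_space X) unit_interval) (?N \<times> ({0..1} \<inter> ball t (e/2)))"
      by (simp add: openin_prod_Times_iff)
    moreover have "w \<in> ?N \<times> ({0..1} \<inter> ball t (e/2))"
      using w \<gamma> t e \<open>\<gamma> ` K \<subseteq> U\<close> by (auto simp: topspace_path_space)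
    moreover have "?N \<times> ({0..1} \<inter> ball t (e/2)) \<subseteq> ?S"
      by (auto simp: topspace_path_space K_def)
    ultimately show "\<exists>T. openin (prod_topology (path_space X) unit_interval) T \<and> w \<in> T \<and> T \<subseteq> ?S"
      by blast
  qed
qed

lemma G_space_act_in:
  assumes "topological_group G T" "G_space G T X \<phi>" "g \<in> carrier G" "x \<in> topspace X"
  shows "\<phi> g x \<in> topspace X"
proof -
  have "continuous_map (prod_topology T X) X (\<lambda>(g, x). \<phi> g x)" "topspace T = carrier G"
    using assms(1,2) by (auto simp: G_space_def topological_group_def)
  then have "(\<lambda>(g, x). \<phi> g x) \<in> topspace (prod_topology T X) \<rightarrow> topspace X"
    "(g, x) \<in> topspace (prod_topology T X)"
    using assms(3,4) by (simp_all add: continuous_map_def)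
  then have "(\<lambda>(g, x). \<phi> g x) (g, x) \<in> topspace X" by (rule funcset_mem)
  then show ?thesis by simp
qed

lemma G_space_path_space:
  assumes G: "topological_group G T" and X: "G_space G T X \<phi>"
  shows "G_space G T (path_space X) (path_action \<phi>)"
  unfolding G_space_def
proof (intro conjI ballI)
  show "Hausdorff_space (path_space X)"
    using X by (simp add: path_space_def G_space_def Hausdorff_compact_open)
  have tT: "topspace T = carrier G" using G by (simp add: topological_group_def)
  have act: "continuous_map (prod_topology T X) X (\<lambda>(g, x). \<phi> g x)"
    using X by (simp add: G_space_def)
  let ?Z = "prod_topology (prod_topology T (path_space X)) unit_interval"
  have "continuous_map ?Z (prod_topology (path_space X) unit_interval) (\<lambda>((g, \<gamma>), t). (\<gamma>, t))"
    unfolding case_prod_unfold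
    by (intro continuous_map_pairedI continuous_map_fst_of continuous_map_snd_of continuous_map_snd
        continuous_map_compose[OF continuous_map_fst continuous_map_snd, unfolded o_def])
  from continuous_map_compose[OF this continuous_map_path_eval]
  have 1: "continuous_map ?Z X (\<lambda>((g, \<gamma>), t). \<gamma> t)"
    by (simp add: o_def case_prod_unfold)
  have "continuous_map ?Z (prod_topology T X) (\<lambda>((g, \<gamma>), t). (g, \<gamma> t))"
    using 1 unfolding case_prod_unfold
    by (intro continuous_map_pairedI
        continuous_map_compose[OF continuous_map_fst continuous_map_fst, unfolded o_def])
  from continuous_map_compose[OF this act]
  have "continuous_map ?Z X (\<lambda>((g, \<gamma>), t). \<phi> g (\<gamma> t))"
    by (simp add: o_def case_prod_unfold)
  from continuous_map_path_curry[OF this]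
  show "continuous_map (prod_topology T (path_space X)) (path_space X) (\<lambda>(g, \<gamma>). path_action \<phi> g \<gamma>)"
    by (simp add: case_prod_unfold path_action_def)
  fix \<gamma> assume \<gamma>: "\<gamma> \<in> topspace (path_space X)"
  have in_X: "\<gamma> t \<in> topspace X" if "t \<in> {0..1}" for t
    using path_space_at[OF \<gamma> that] .
  show "path_action \<phi> \<one>\<^bsub>G\<^esub> \<gamma> = \<gamma>"
    using \<gamma> X in_X by (auto simp: path_action_def G_space_def topspace_path_space extensional_def)
  fix g h assume "g \<in> carrier G" "h \<in> carrier G"
  then show "path_action \<phi> (g \<otimes>\<^bsub>G\<^esub> h) \<gamma> = path_action \<phi> g (path_action \<phi> h \<gamma>)"
    using X in_X by (auto simp: path_action_def G_space_def)
qed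

lemma G_fibration_imp_G_HLP:
  fixes E :: "'e topology" and B :: "'b topology"
  assumes G: "topological_group G T" and fib: "G_fibration G T E \<phi> B \<psi> p"
  shows "G_HLP TYPE('x) G T E \<phi> B \<psi> p"
proof -
  have tT: "topspace T = carrier G" using G by (simp add: topological_group_def)
  have E: "G_space G T E \<phi>" and B: "G_space G T B \<psi>" and p: "G_map G E \<phi> B \<psi> p"
    and hlp: "G_HLP TYPE('e \<times> (real \<Rightarrow> 'b)) G T E \<phi> B \<psi> p"
    using fib by (auto simp: G_fibration_def)
  note PB = G_space_path_space[OF G B]
  define N where "N = subtopology (prod_topology E (path_space B)) {(e, \<beta>). p e = \<beta> 0}"
  define \<nu> where "\<nu> g = (\<lambda>(e, \<beta>). (\<phi> g e, path_action \<psi> g \<beta>))" for g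
  have tN: "topspace N = {(e, \<beta>). e \<in> topspace E \<and> \<beta> \<in> topspace (path_space B) \<and> p e = \<beta> 0}"
    by (auto simp: N_def)
  have \<nu>_in: "\<nu> g w \<in> topspace N" if "g \<in> carrier G" "w \<in> topspace N" for g w
    using that G_space_act_in[OF G E] G_space_act_in[OF G PB] p
    by (auto simp: tN \<nu>_def G_map_def equivariant_def path_action_def)
  have cNE: "continuous_map N E fst" and cNP: "continuous_map N (path_space B) snd"
    unfolding N_def by (auto intro: continuous_map_from_subtopology continuous_map_fst continuous_map_snd)
  have N: "G_space G T N \<nu>"
    unfolding G_space_def
  proof (intro conjI ballI)
    show "Hausdorff_space N"
      using E PB by (auto simp: N_def G_space_def Hausdorff_space_prod_topology intro!: Hausdorff_space_subtopology)
    have cE: "continuous_map (prod_topology T E) E (\<lambda>(g, x). \<phi> g x)"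
      and cP: "continuous_map (prod_topology T (path_space B)) (path_space B) (\<lambda>(g, x). path_action \<psi> g x)"
      using E PB by (auto simp: G_space_def)
    have "continuous_map (prod_topology T N) (prod_topology T E) (\<lambda>w. (fst w, fst (snd w)))"
      by (intro continuous_map_pairedI continuous_map_fst
          continuous_map_compose[OF continuous_map_snd cNE, unfolded o_def])
    from continuous_map_compose[OF this cE]
    have 1: "continuous_map (prod_topology T N) E (\<lambda>w. \<phi> (fst w) (fst (snd w)))"
      by (simp add: o_def)
    have "continuous_map (prod_topology T N) (prod_topology T (path_space B)) (\<lambda>w. (fst w, snd (snd w)))"
      by (intro continuous_map_pairedI continuous_map_fst
          continuous_map_compose[OF continuous_map_snd cNP, unfolded o_def])
    from continuous_map_compose[OF this cP]
    have 2: "continuous_map (prod_topology T N) (path_space B) (\<lambda>w. path_action \<psi> (fst w) (snd (snd w)))"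
      by (simp add: o_def)
    have "continuous_map (prod_topology T N) (prod_topology E (path_space B)) (\<lambda>(g, w). \<nu> g w)"
      using continuous_map_pairedI[OF 1 2] by (simp add: \<nu>_def case_prod_unfold)
    moreover have "(\<lambda>(g, w). \<nu> g w) \<in> topspace (prod_topology T N) \<rightarrow> {(e, \<beta>). p e = \<beta> 0}"
      using \<nu>_in tT tN by fastforce
    ultimately show "continuous_map (prod_topology T N) N (\<lambda>(g, w). \<nu> g w)"
      unfolding N_def by (intro continuous_map_into_subtopology) (auto simp: N_def)
    fix w assume "w \<in> topspace N"
    then show "\<nu> \<one>\<^bsub>G\<^esub> w = w"
      using E PB by (auto simp: tN \<nu>_def G_space_def)
    fix g h assume "g \<in> carrier G" "h \<in> carrier G"
    then show "\<nu> (g \<otimes>\<^bsub>G\<^esub> h) w = \<nu> g (\<nu> h w)"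
      using E PB \<open>w \<in> topspace N\<close> by (auto simp: tN \<nu>_def G_space_def)
  qed
  have f: "G_map G N \<nu> E \<phi> fst"
    using cNE by (auto simp: G_map_def equivariant_def \<nu>_def)
  have "continuous_map (prod_topology unit_interval N) (prod_topology (path_space B) unit_interval)
      (\<lambda>w. (snd (snd w), fst w))"
    by (intro continuous_map_pairedI continuous_map_fst
        continuous_map_compose[OF continuous_map_snd cNP, unfolded o_def])
  from continuous_map_compose[OF this continuous_map_path_eval]
  have "G_homotopy G N \<nu> B \<psi> (\<lambda>w. snd (snd w) (fst w))"
    by (auto simp: G_homotopy_def equivariant_def o_def \<nu>_def path_action_def case_prod_unfold)
  moreover have "\<forall>w\<in>topspace N. snd (snd (0::real, w)) (fst (0, w)) = p (fst w)"
    by (auto simp: tN)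
  ultimately have "\<exists>k. G_homotopy G N \<nu> E \<phi> k \<and> (\<forall>w\<in>topspace N. k (0, w) = fst w) \<and>
      (\<forall>t\<in>{0..1}. \<forall>w\<in>topspace N. p (k (t, w)) = snd (snd (t, w)) (fst (t, w)))"
    using N f hlp unfolding G_HLP_def by blast
  then obtain k where k: "G_homotopy G N \<nu> E \<phi> k" "\<forall>w\<in>topspace N. k (0, w) = fst w"
      "\<forall>t\<in>{0..1}. \<forall>w\<in>topspace N. p (k (t, w)) = snd w t"
    by auto
  show ?thesis
    unfolding G_HLP_def
  proof (intro allI impI, elim conjE)
    fix X :: "'x topology" and \<xi> f h
    assume X: "G_space G T X \<xi>" and f: "G_map G X \<xi> E \<phi> f" and h: "G_homotopy G X \<xi> B \<psi> h"
      and h0: "\<forall>x\<in>topspace X. h (0, x) = p (f x)"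
    define \<Phi> where "\<Phi> x = (f x, \<lambda>t\<in>{0..1}. h (t, x))" for x
    have "continuous_map (prod_topology X unit_interval) (prod_topology unit_interval X) (\<lambda>w. (snd w, fst w))"
      by (intro continuous_map_pairedI continuous_map_fst continuous_map_snd)
    from continuous_map_compose[OF this] h
    have "continuous_map (prod_topology X unit_interval) B (\<lambda>w. h (snd w, fst w))"
      by (auto simp: G_homotopy_def o_def)
    from continuous_map_path_curry[OF this]
    have "continuous_map X (path_space B) (\<lambda>x. \<lambda>t\<in>{0..1}. h (t, x))"
      by simp
    then have c: "continuous_map X (prod_topology E (path_space B)) \<Phi>"
      unfolding \<Phi>_def using f by (intro continuous_map_pairedI) (auto simp: G_map_def)
    then have \<Phi>: "continuous_map X N \<Phi>"
      unfolding N_def using h0 by (intro continuous_map_into_subtopology) (auto simp: \<Phi>_def)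
    then have \<Phi>_in: "\<Phi> x \<in> topspace N" if "x \<in> topspace X" for x
      using that by (auto simp: continuous_map_def)
    have eq: "\<Phi> (\<xi> g x) = \<nu> g (\<Phi> x)" if "g \<in> carrier G" "x \<in> topspace X" for g x
      using that f h by (auto simp: \<Phi>_def \<nu>_def G_map_def G_homotopy_def equivariant_def path_action_def)
    have "continuous_map (prod_topology unit_interval X) (prod_topology unit_interval N) (\<lambda>w. (fst w, \<Phi> (snd w)))"
      by (intro continuous_map_pairedI continuous_map_fst
          continuous_map_compose[OF continuous_map_snd \<Phi>, unfolded o_def])
    from continuous_map_compose[OF this] k(1)
    have "continuous_map (prod_topology unit_interval X) E (\<lambda>w. k (fst w, \<Phi> (snd w)))"
      by (auto simp: G_homotopy_def o_def)
    then have "G_homotopy G X \<xi> E \<phi> (\<lambda>w. k (fst w, \<Phi> (snd w)))"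
      using k(1) eq \<Phi>_in by (auto simp: G_homotopy_def equivariant_def)
    moreover have "\<forall>x\<in>topspace X. k (0, \<Phi> x) = f x"
      using k(2) \<Phi>_in by (simp add: \<Phi>_def)
    moreover have "\<forall>t\<in>{0..1}. \<forall>x\<in>topspace X. p (k (t, \<Phi> x)) = h (t, x)"
      using k(3) \<Phi>_in by (simp add: \<Phi>_def)
    ultimately show "\<exists>k. G_homotopy G X \<xi> E \<phi> k \<and> (\<forall>x\<in>topspace X. k (0, x) = f x) \<and>
        (\<forall>t\<in>{0..1}. \<forall>x\<in>topspace X. p (k (t, x)) = h (t, x))"
      by (intro exI[of _ "\<lambda>w. k (fst w, \<Phi> (snd w))"]) simp
  qed
qed

end

theory Submission
  imports Defs
begin

text \<open>
  The covers and local sections that compute \<open>TC\<^sup>G[p: E \<rightarrow> B]\<close> restrict to \<open>E'\<close>, once the local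
  sections are strict. A section \<open>s\<close> on \<open>U\<close> with \<open>\<Psi> \<circ> s\<close> merely homotopic to the inclusion is of
  no direct use: the homotopy may leave \<open>E' \<times> E'\<close>, and the paths in \<open>s(e\<^sub>1, e\<^sub>2)\<close> need not
  start or end in \<open>E'\<close>. But \<open>\<Psi>\<close> is a \<open>(G \<times> G)\<close>-fibration, so the homotopy can be
  lifted and its end stage is an equivariant \<open>s'\<close> with \<open>\<Psi> \<circ> s'\<close> equal to the inclusion
  (\<open>G_fibration_strict_section\<close>). Such sections restrict to invariant subsets of the base, so the
  equivariant sectional category of a fibration does not increase under restriction
  (\<open>secat_G_restriction_le\<close>).

  It remains to see that the part of the source of \<open>\<Psi>\<close> that lies over \<open>E' \<times> E'\<close> maps into
  the source of the map \<open>\<Psi>\<close> of \<open>p'\<close>. A path in \<open>E\<close> that runs in a single fibre of \<open>p\<close> and meets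
  \<open>E' = p\<^sup>-\<^sup>1(B')\<close> lies entirely in \<open>E'\<close>, since the fibre does
  (\<open>continuous_map_orbit_joined_pairs_restrict\<close>).

  The fibre \<open>F\<close> over a fixed point \<open>b\<close> is the case \<open>B' = {b}\<close>: over a single point every path is
  a path in a fibre and all pairs have the same base orbit, so the parametrized invariant is
  \<open>TC\<^sup>G(F)\<close> (\<open>inv_param_TC_over_point\<close>).
\<close>

section \<open>Products of groups and invariant subspaces\<close>

lemma topological_group_DirProd:
  assumes "topological_group G T" "topological_group H S"
  shows "topological_group (G \<times>\<times> H) (prod_topology T S)"
proof -
  interpret G: group G using assms by (simp add: topological_group_def)
  interpret H: group H using assms by (simp add: topological_group_def)
  have tT: "topspace T = carrier G" and tS: "topspace S = carrier H"
    using assms by (auto simp: topological_group_def)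
  have mult: "continuous_map (prod_topology T T) T (\<lambda>w. fst w \<otimes>\<^bsub>G\<^esub> snd w)"
      "continuous_map (prod_topology S S) S (\<lambda>w. fst w \<otimes>\<^bsub>H\<^esub> snd w)"
    and inv: "continuous_map T T (\<lambda>g. inv\<^bsub>G\<^esub> g)" "continuous_map S S (\<lambda>h. inv\<^bsub>H\<^esub> h)"
    using assms by (auto simp: topological_group_def case_prod_unfold)
  let ?Q = "prod_topology (prod_topology T S) (prod_topology T S)"
  have "continuous_map ?Q (prod_topology T T) (\<lambda>w. (fst (fst w), fst (snd w)))"
    "continuous_map ?Q (prod_topology S S) (\<lambda>w. (snd (fst w), snd (snd w)))"
    by (intro continuous_map_pairedI
        continuous_map_compose[OF continuous_map_fst continuous_map_fst, unfolded o_def]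
        continuous_map_compose[OF continuous_map_snd continuous_map_fst, unfolded o_def]
        continuous_map_compose[OF continuous_map_fst continuous_map_snd, unfolded o_def]
        continuous_map_compose[OF continuous_map_snd continuous_map_snd, unfolded o_def])+
  from continuous_map_compose[OF this(1) mult(1)] continuous_map_compose[OF this(2) mult(2)]
  have m: "continuous_map ?Q (prod_topology T S)
      (\<lambda>w. (fst (fst w) \<otimes>\<^bsub>G\<^esub> fst (snd w), snd (fst w) \<otimes>\<^bsub>H\<^esub> snd (snd w)))"
    by (intro continuous_map_pairedI) (simp_all add: o_def)
  have i: "continuous_map (prod_topology T S) (prod_topology T S)
      (\<lambda>w. (inv\<^bsub>G\<^esub> (fst w), inv\<^bsub>H\<^esub> (snd w)))"
    by (intro continuous_map_pairedI continuous_map_compose[OF continuous_map_fst inv(1), unfolded o_def]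
        continuous_map_compose[OF continuous_map_snd inv(2), unfolded o_def])
  have "continuous_map (prod_topology T S) (prod_topology T S) (\<lambda>w. inv\<^bsub>G \<times>\<times> H\<^esub> w)"
    using i by (rule continuous_map_eq)
      (auto simp: tT tS inv_DirProd[OF G.group_axioms H.group_axioms])
  moreover have "continuous_map ?Q (prod_topology T S) (\<lambda>(v, w). v \<otimes>\<^bsub>G \<times>\<times> H\<^esub> w)"
    using m by (simp add: DirProd_def case_prod_unfold)
  ultimately show ?thesis
    using assms DirProd_group[OF G.group_axioms H.group_axioms] unfolding topological_group_def
    by (simp add: Hausdorff_space_prod_topology)
qed

lemma G_space_subtopology:
  assumes "topological_group G T" "G_space G T X \<phi>" "invariant_set G \<phi> (topspace X \<inter> S)"
  shows "G_space G T (subtopology X S) \<phi>"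
proof -
  have tT: "topspace T = carrier G" using assms by (simp add: topological_group_def)
  have "continuous_map (prod_topology T (subtopology X S)) X (\<lambda>(g, x). \<phi> g x)"
    using assms(2) by (simp add: G_space_def prod_topology_subtopology continuous_map_from_subtopology)
  then have "continuous_map (prod_topology T (subtopology X S)) (subtopology X S) (\<lambda>(g, x). \<phi> g x)"
    using assms(3) tT by (intro continuous_map_into_subtopology) (auto simp: invariant_set_def)
  then show ?thesis
    using assms(2) by (auto simp: G_space_def Hausdorff_space_subtopology)
qed

lemma G_map_preimage_invariant:
  assumes "topological_group G T" "G_space G T E \<phi>" "G_map G E \<phi> B \<psi> p" "invariant_set G \<psi> S"
  shows "invariant_set G \<phi> {e \<in> topspace E. p e \<in> S}"
  using assms G_space_act_in[OF assms(1,2)]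
  by (auto simp: invariant_set_def G_map_def equivariant_def)

text \<open>A lift along \<open>p\<close> of a homotopy with values in \<open>B'\<close> has values in the preimage of \<open>B'\<close>.\<close>

lemma G_fibration_restrict:
  fixes E :: "'e topology" and B :: "'b topology"
  assumes G: "topological_group G T" and fib: "G_fibration G T E \<phi> B \<psi> p"
    and B': "invariant_set G \<psi> B'" "B' \<subseteq> topspace B" and E': "E' = {e \<in> topspace E. p e \<in> B'}"
  shows "G_fibration G T (subtopology E E') \<phi> (subtopology B B') \<psi> p"
proof -
  have E: "G_space G T E \<phi>" and B: "G_space G T B \<psi>" and p: "G_map G E \<phi> B \<psi> p"
    and hlp: "G_HLP TYPE('e \<times> (real \<Rightarrow> 'b)) G T E \<phi> B \<psi> p"
    using fib by (auto simp: G_fibration_def)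
  have "invariant_set G \<phi> E'"
    using G_map_preimage_invariant[OF G E p B'(1)] by (simp add: E')
  then have 1: "G_space G T (subtopology E E') \<phi>" "G_space G T (subtopology B B') \<psi>"
    using B' E' by (auto intro!: G_space_subtopology G E B simp: Int_absorb1 subset_iff
        invariant_set_def)
  have 2: "G_map G (subtopology E E') \<phi> (subtopology B B') \<psi> p"
    using p E' by (auto simp: G_map_def equivariant_def continuous_map_in_subtopology
        continuous_map_from_subtopology)
  have "G_HLP TYPE('e \<times> (real \<Rightarrow> 'b)) G T (subtopology E E') \<phi> (subtopology B B') \<psi> p"
    unfolding G_HLP_def
  proof (intro allI impI, elim conjE)
    fix X :: "('e \<times> (real \<Rightarrow> 'b)) topology" and \<xi> f h
    assume X: "G_space G T X \<xi>" and f: "G_map G X \<xi> (subtopology E E') \<phi> f"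
      and h: "G_homotopy G X \<xi> (subtopology B B') \<psi> h"
      and h0: "\<forall>x\<in>topspace X. h (0, x) = p (f x)"
    have "G_map G X \<xi> E \<phi> f" "G_homotopy G X \<xi> B \<psi> h"
      using f h by (auto simp: G_map_def G_homotopy_def continuous_map_in_subtopology)
    then obtain k where k: "G_homotopy G X \<xi> E \<phi> k" "\<forall>x\<in>topspace X. k (0, x) = f x"
        "\<forall>t\<in>{0..1}. \<forall>x\<in>topspace X. p (k (t, x)) = h (t, x)"
      using hlp X h0 unfolding G_HLP_def by blast
    have "h w \<in> B'" if "w \<in> topspace (prod_topology unit_interval X)" for w
      using h that by (auto simp: G_homotopy_def continuous_map_in_subtopology)
    then have "k w \<in> E'" if "w \<in> topspace (prod_topology unit_interval X)" for w
      using that k(1,3) continuous_map_image_subset_topspace[of _ E k]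
      by (fastforce simp: E' G_homotopy_def)
    then have "G_homotopy G X \<xi> (subtopology E E') \<phi> k"
      using k(1) by (auto simp: G_homotopy_def intro!: continuous_map_into_subtopology)
    then show "\<exists>k. G_homotopy G X \<xi> (subtopology E E') \<phi> k \<and> (\<forall>x\<in>topspace X. k (0, x) = f x) \<and>
        (\<forall>t\<in>{0..1}. \<forall>x\<in>topspace X. p (k (t, x)) = h (t, x))"
      using k by blast
  qed
  then show ?thesis using 1 2 by (simp add: G_fibration_def)
qed

section \<open>Sectional category of fibrations\<close>

text \<open>Lifting the homotopy from \<open>q \<circ> s\<close> to the inclusion, starting at \<open>s\<close>, ends at a strict
  section.\<close>

lemma G_fibration_strict_section:
  fixes X :: "'x topology" and Y :: "'y topology"
  assumes G: "topological_group G T" and fib: "G_fibration G T X \<phi> Y \<psi> q"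
    and U: "invariant_set G \<psi> U" "U \<subseteq> topspace Y"
    and s: "G_map G (subtopology Y U) \<psi> X \<phi> s"
    and hom: "G_homotopic G (subtopology Y U) \<psi> Y \<psi> (\<lambda>y. q (s y)) (\<lambda>y. y)"
  obtains s' where "G_map G (subtopology Y U) \<psi> X \<phi> s'" "\<And>y. y \<in> U \<Longrightarrow> q (s' y) = y"
proof -
  let ?U = "subtopology Y U"
  have tU: "topspace ?U = U" using U by auto
  have "G_space G T ?U \<psi>"
    using fib U by (intro G_space_subtopology[OF G]) (auto simp: G_fibration_def Int_absorb1)
  moreover obtain h where h: "G_homotopy G ?U \<psi> Y \<psi> h"
      "\<And>y. h (0, y) = q (s y)" "\<And>y. h (1, y) = y"
    using hom unfolding G_homotopic_def homotopic_with_def G_homotopy_def by auto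
  moreover have "G_HLP TYPE('y) G T X \<phi> Y \<psi> q"
    by (rule G_fibration_imp_G_HLP[OF G fib])
  ultimately obtain k where k: "G_homotopy G ?U \<psi> X \<phi> k"
      "\<forall>t\<in>{0..1}. \<forall>y\<in>topspace ?U. q (k (t, y)) = h (t, y)"
    using s unfolding G_HLP_def by blast
  have "continuous_map ?U (prod_topology unit_interval ?U) (\<lambda>y. (1, y))"
    by (intro continuous_intros) auto
  from continuous_map_compose[OF this] k(1)
  have "continuous_map ?U X (\<lambda>y. k (1, y))"
    by (auto simp: G_homotopy_def o_def)
  then have "G_map G ?U \<psi> X \<phi> (\<lambda>y. k (1, y))"
    using k(1) by (auto simp: G_homotopy_def G_map_def)
  moreover have "q (k (1, y)) = y" if "y \<in> U" for y
    using k(2) h(3) that tU by simp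
  ultimately show thesis by (rule that)
qed

text \<open>The total space \<open>X'\<close> may carry any topology into which the preimage of \<open>S\<close> maps
  continuously, so that a path space in a subspace need not first be identified with a subspace
  of the path space.\<close>

lemma secat_G_restriction_le:
  assumes G: "topological_group G T" and fib: "G_fibration G T X \<phi> Y \<psi> q"
    and S: "invariant_set G \<psi> (topspace Y \<inter> S)"
    and X': "continuous_map (subtopology X {x. q x \<in> S}) X' (\<lambda>x. x)"
  shows "secat_G G X' \<phi> (subtopology Y S) \<psi> q \<le> secat_G G X \<phi> Y \<psi> q"
  unfolding secat_G_def
proof (rule Inf_superset_mono, clarify)
  fix k :: nat and U
  assume k: "1 \<le> k" and cover: "(\<Union>i<k. U i) = topspace Y"
    and U: "\<forall>i<k. openin Y (U i) \<and> invariant_set G \<psi> (U i) \<and>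
       (\<exists>s. G_map G (subtopology Y (U i)) \<psi> X \<phi> s \<and>
            G_homotopic G (subtopology Y (U i)) \<psi> Y \<psi> (\<lambda>y. q (s y)) (\<lambda>y. y))"
  let ?Y = "subtopology Y S"
  have "openin ?Y (U i \<inter> S) \<and> invariant_set G \<psi> (U i \<inter> S) \<and>
     (\<exists>s. G_map G (subtopology ?Y (U i \<inter> S)) \<psi> X' \<phi> s \<and>
          G_homotopic G (subtopology ?Y (U i \<inter> S)) \<psi> ?Y \<psi> (\<lambda>y. q (s y)) (\<lambda>y. y))"
    if i: "i < k" for i
  proof (intro conjI)
    have o: "openin Y (U i)" and inv: "invariant_set G \<psi> (U i)" using U i by auto
    have sub: "U i \<subseteq> topspace Y" using o by (rule openin_subset)
    show "openin ?Y (U i \<inter> S)" using o by (auto simp: openin_subtopology)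
    show inv': "invariant_set G \<psi> (U i \<inter> S)"
      using inv S sub by (auto simp: invariant_set_def)
    obtain s where s: "G_map G (subtopology Y (U i)) \<psi> X \<phi> s" "\<And>y. y \<in> U i \<Longrightarrow> q (s y) = y"
      using U i G_fibration_strict_section[OF G fib inv sub] by metis
    let ?V = "subtopology ?Y (U i \<inter> S)"
    have V: "?V = subtopology (subtopology Y (U i)) S"
      by (simp add: subtopology_subtopology Int_ac)
    have tV: "topspace ?V = U i \<inter> S" using sub by auto
    have "continuous_map ?V X s"
      unfolding V using s(1) by (simp add: G_map_def continuous_map_from_subtopology)
    then have "continuous_map ?V (subtopology X {x. q x \<in> S}) s"
      using s(2) tV by (intro continuous_map_into_subtopology) auto
    from continuous_map_compose[OF this X']
    have "G_map G ?V \<psi> X' \<phi> s"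
      using s(1) by (auto simp: G_map_def equivariant_def o_def)
    moreover have "homotopic_with (equivariant G ?V \<psi> \<psi>) ?V ?Y (\<lambda>y. y) (\<lambda>y. q (s y))"
    proof (rule homotopic_with_equal)
      show "continuous_map ?V ?Y (\<lambda>y. y)"
        by (simp add: continuous_map_from_subtopology)
      show "equivariant G ?V \<psi> \<psi> (\<lambda>y. q (s y))"
        using s(2) inv' tV by (auto simp: equivariant_def invariant_set_def)
    qed (use s(2) tV in \<open>auto simp: equivariant_def\<close>)
    ultimately show "\<exists>s. G_map G ?V \<psi> X' \<phi> s \<and> G_homotopic G ?V \<psi> ?Y \<psi> (\<lambda>y. q (s y)) (\<lambda>y. y)"
      unfolding G_homotopic_def using homotopic_with_symD by blast
  qed
  moreover have "(\<Union>i<k. U i \<inter> S) = topspace ?Y" using cover by auto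
  ultimately show "\<exists>k'. enat k = enat k' \<and> 1 \<le> k' \<and>
      (\<exists>U. (\<Union>i<k'. U i) = topspace ?Y \<and>
        (\<forall>i<k'. openin ?Y (U i) \<and> invariant_set G \<psi> (U i) \<and>
          (\<exists>s. G_map G (subtopology ?Y (U i)) \<psi> X' \<phi> s \<and>
               G_homotopic G (subtopology ?Y (U i)) \<psi> ?Y \<psi> (\<lambda>y. q (s y)) (\<lambda>y. y))))"
    using k by (intro exI[of _ k] conjI refl exI[of _ "\<lambda>i. U i \<inter> S"]) auto
qed

section \<open>Paths in a fibre that meet an invariant part\<close>

text \<open>A continuous family of paths is a continuous map on the product with the interval, and such a
  map may be corestricted to any subspace that contains its values.\<close>

lemma continuous_map_into_path_space_subtopology:
  assumes "continuous_map Z (path_space X) f"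
    and "\<And>z t. z \<in> topspace Z \<Longrightarrow> t \<in> {0..1} \<Longrightarrow> f z t \<in> S"
  shows "continuous_map Z (path_space (subtopology X S)) f"
proof -
  have "continuous_map (prod_topology Z unit_interval) (prod_topology (path_space X) unit_interval)
      (\<lambda>w. (f (fst w), snd w))"
    by (intro continuous_map_pairedI continuous_map_snd
        continuous_map_compose[OF continuous_map_fst assms(1), unfolded o_def])
  from continuous_map_compose[OF this continuous_map_path_eval]
  have "continuous_map (prod_topology Z unit_interval) X (\<lambda>(z, t). f z t)"
    by (simp add: o_def case_prod_unfold)
  then have "continuous_map (prod_topology Z unit_interval) (subtopology X S) (\<lambda>(z, t). f z t)"
    using assms(2) by (intro continuous_map_into_subtopology) auto
  from continuous_map_path_curry[OF this]
  have "continuous_map Z (path_space (subtopology X S)) (\<lambda>z. \<lambda>t\<in>{0..1}. f z t)"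
    by simp
  then show ?thesis
  proof (rule continuous_map_eq)
    fix z assume "z \<in> topspace Z"
    then have "f z \<in> topspace (path_space X)"
      using assms(1) by (auto simp: continuous_map_def)
    then show "(\<lambda>t\<in>{0..1}. f z t) = f z"
      by (simp add: topspace_path_space extensional_restrict)
  qed
qed

text \<open>The first path of a pair is caught in \<open>E'\<close> by its starting point, the second by its end
  point: \<open>p\<close> is constant along each of them.\<close>

lemma continuous_map_orbit_joined_pairs_restrict:
  assumes E': "E' = {e \<in> topspace E. p e \<in> B'}" and B': "B' \<subseteq> topspace B"
  shows "continuous_map
     (subtopology (orbit_joined_pairs G \<phi> (fibre_path_space E B p)) {w. outer_endpoints w \<in> E' \<times> E'})
     (orbit_joined_pairs G \<phi> (fibre_path_space (subtopology E E') (subtopology B B') p)) (\<lambda>w. w)"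
    (is "continuous_map ?Z _ _")
proof -
  have path: "continuous_map ?Z (fibre_path_space (subtopology E E') (subtopology B B') p) f"
    if f: "continuous_map ?Z (fibre_path_space E B p) f"
      and r: "r \<in> {0..1}" "\<And>w. w \<in> topspace ?Z \<Longrightarrow> f w r \<in> E'" for f and r :: real
  proof -
    have fE: "continuous_map ?Z (path_space E) f"
      using f by (simp add: fibre_path_space_def continuous_map_in_subtopology)
    have const: "p (f w t) = p (f w r)" if "w \<in> topspace ?Z" "t \<in> {0..1}" for w t
    proof -
      have "f w \<in> topspace (fibre_path_space E B p)"
        using f that(1) by (meson continuous_map_image_subset_topspace image_subset_iff)
      then show ?thesis using that(2) r(1) by (force simp: fibre_path_space_def)
    qed
    have pB': "p (f w r) \<in> B'" if "w \<in> topspace ?Z" for w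
      using r(2)[OF that] E' by simp
    have inE': "f w t \<in> E'" if wt: "w \<in> topspace ?Z" "t \<in> {0..1}" for w t
    proof -
      have "f w \<in> topspace (path_space E)"
        using fE wt(1) by (meson continuous_map_image_subset_topspace image_subset_iff)
      then have "f w t \<in> topspace E" using wt(2) by (rule path_space_at)
      then show ?thesis using const[OF wt] pB'[OF wt(1)] E' by simp
    qed
    have "continuous_map ?Z (path_space (subtopology E E')) f"
      using fE inE' by (rule continuous_map_into_path_space_subtopology)
    moreover have "\<exists>b\<in>topspace (subtopology B B'). \<forall>t\<in>{0..1}. p (f w t) = b"
      if "w \<in> topspace ?Z" for w
      using const[OF that] pB'[OF that] B' by (intro bexI[of _ "p (f w r)"]) auto
    ultimately show ?thesis
      unfolding fibre_path_space_def by (intro continuous_map_into_subtopology) auto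
  qed
  have c: "continuous_map ?Z (fibre_path_space E B p) fst" "continuous_map ?Z (fibre_path_space E B p) snd"
    unfolding orbit_joined_pairs_def
    by (intro continuous_map_from_subtopology continuous_map_fst continuous_map_snd)+
  have "continuous_map ?Z (fibre_path_space (subtopology E E') (subtopology B B') p) fst"
    by (rule path[where r = 0, OF c(1)]) (auto simp: outer_endpoints_def)
  moreover have "continuous_map ?Z (fibre_path_space (subtopology E E') (subtopology B B') p) snd"
    by (rule path[where r = 1, OF c(2)]) (auto simp: outer_endpoints_def)
  ultimately have "continuous_map ?Z (prod_topology
      (fibre_path_space (subtopology E E') (subtopology B B') p)
      (fibre_path_space (subtopology E E') (subtopology B B') p)) (\<lambda>w. (fst w, snd w))"
    by (rule continuous_map_pairedI)
  then show ?thesis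
    unfolding orbit_joined_pairs_def[of G \<phi> "fibre_path_space (subtopology E E') (subtopology B B') p"]
    by (intro continuous_map_into_subtopology) (auto simp: orbit_joined_pairs_def)
qed

section \<open>The invariant topological complexities\<close>

lemma same_base_orbit_subtopology:
  "same_base_orbit G (subtopology E S) \<psi> p = subtopology (same_base_orbit G E \<psi> p) (S \<times> S)"
  unfolding same_base_orbit_def subtopology_Times[symmetric] subtopology_subtopology
  by (simp only: Int_commute)

lemma inv_param_TC_restrict_le:
  assumes G: "topological_group G T" and fib: "G_fibration G T E \<phi> B \<psi> p"
    and \<Psi>: "Psi_is_fibration G T E \<phi> B \<psi> p"
    and B': "invariant_set G \<psi> B'" "B' \<subseteq> topspace B" and E': "E' = {e \<in> topspace E. p e \<in> B'}"
  shows "inv_param_TC G (subtopology E E') \<phi> (subtopology B B') \<psi> p \<le> inv_param_TC G E \<phi> B \<psi> p"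
  unfolding inv_param_TC_def same_base_orbit_subtopology
proof (rule secat_G_restriction_le)
  show "topological_group (G \<times>\<times> G) (prod_topology T T)"
    using G G by (rule topological_group_DirProd)
  show fib\<Psi>: "G_fibration (G \<times>\<times> G) (prod_topology T T)
       (orbit_joined_pairs G \<phi> (fibre_path_space E B p)) (prod_action (path_action \<phi>) (path_action \<phi>))
       (same_base_orbit G E \<psi> p) (prod_action \<phi> \<phi>) outer_endpoints"
    using \<Psi> by (simp add: Psi_is_fibration_def)
  have "G_space (G \<times>\<times> G) (prod_topology T T) (same_base_orbit G E \<psi> p) (prod_action \<phi> \<phi>)"
    using fib\<Psi> by (simp add: G_fibration_def)
  note act_in = G_space_act_in[OF topological_group_DirProd[OF G G] this]
  have "invariant_set G \<phi> E'"
    using G_map_preimage_invariant[OF G _ _ B'(1)] fib by (auto simp: E' G_fibration_def)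
  then have "prod_action \<phi> \<phi> g w \<in> E' \<times> E'" if "g \<in> carrier (G \<times>\<times> G)" "w \<in> E' \<times> E'" for g w
    using that by (auto simp: invariant_set_def prod_action_def)
  then show "invariant_set (G \<times>\<times> G) (prod_action \<phi> \<phi>) (topspace (same_base_orbit G E \<psi> p) \<inter> E' \<times> E')"
    unfolding invariant_set_def by (intro ballI IntI act_in) (simp_all only: Int_iff)
  show "continuous_map
     (subtopology (orbit_joined_pairs G \<phi> (fibre_path_space E B p)) {w. outer_endpoints w \<in> E' \<times> E'})
     (orbit_joined_pairs G \<phi> (fibre_path_space (subtopology E E') (subtopology B B') p)) (\<lambda>w. w)"
    using E' B'(2) by (rule continuous_map_orbit_joined_pairs_restrict)
qed

lemma inv_param_TC_over_point:
  assumes "b \<in> topspace B" "\<And>e. e \<in> topspace E \<Longrightarrow> p e = b"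
  shows "inv_param_TC G E \<phi> B \<psi> p = inv_TC G E \<phi>"
proof -
  have "fibre_path_space E B p = path_space E"
    unfolding fibre_path_space_def
    using assms by (intro subtopology_superset) (auto intro!: bexI[of _ b] dest: path_space_at)
  moreover have "same_base_orbit G E \<psi> p = prod_topology E E"
    unfolding same_base_orbit_def using assms(2) by (intro subtopology_superset) auto
  ultimately show ?thesis by (simp add: inv_param_TC_def inv_TC_def)
qed

theorem proposition4p8:
  fixes G :: "'g monoid" and T :: "'g topology"
    and E :: "'e topology" and \<phi> :: "'g \<Rightarrow> 'e \<Rightarrow> 'e"
    and B :: "'b topology" and \<psi> :: "'g \<Rightarrow> 'b \<Rightarrow> 'b"
    and p :: "'e \<Rightarrow> 'b"
  assumes "topological_group G T"
    and "G_fibration G T E \<phi> B \<psi> p"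
    and "Psi_is_fibration G T E \<phi> B \<psi> p"
  shows "(\<forall>B' E'. B' \<subseteq> topspace B \<and> invariant_set G \<psi> B' \<and> E' = {e \<in> topspace E. p e \<in> B'} \<longrightarrow>
            G_fibration G T (subtopology E E') \<phi> (subtopology B B') \<psi> p \<and>
            inv_param_TC G (subtopology E E') \<phi> (subtopology B B') \<psi> p \<le> inv_param_TC G E \<phi> B \<psi> p)
       \<and> (\<forall>b F. b \<in> topspace B \<and> (\<forall>g\<in>carrier G. \<psi> g b = b) \<and> F = {e \<in> topspace E. p e = b} \<longrightarrow>
            G_space G T (subtopology E F) \<phi> \<and>
            inv_TC G (subtopology E F) \<phi> \<le> inv_param_TC G E \<phi> B \<psi> p)"
proof (intro conjI allI impI; elim conjE)
  fix B' E'
  assume B': "B' \<subseteq> topspace B" "invariant_set G \<psi> B'" and E': "E' = {e \<in> topspace E. p e \<in> B'}"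
  show "G_fibration G T (subtopology E E') \<phi> (subtopology B B') \<psi> p"
    using assms(1,2) B'(2,1) E' by (rule G_fibration_restrict)
  show "inv_param_TC G (subtopology E E') \<phi> (subtopology B B') \<psi> p \<le> inv_param_TC G E \<phi> B \<psi> p"
    using assms B'(2,1) E' by (rule inv_param_TC_restrict_le)
next
  fix b F
  assume b: "b \<in> topspace B" "\<forall>g\<in>carrier G. \<psi> g b = b" and F: "F = {e \<in> topspace E. p e = b}"
  have B': "invariant_set G \<psi> {b}" "{b} \<subseteq> topspace B" and F': "F = {e \<in> topspace E. p e \<in> {b}}"
    using b F by (auto simp: invariant_set_def)
  show "G_space G T (subtopology E F) \<phi>"
    using G_fibration_restrict[OF assms(1,2) B' F'] by (simp add: G_fibration_def)
  have "inv_TC G (subtopology E F) \<phi> = inv_param_TC G (subtopology E F) \<phi> (subtopology B {b}) \<psi> p"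
    using b F by (intro inv_param_TC_over_point[symmetric, where b = b]) auto
  also have "\<dots> \<le> inv_param_TC G E \<phi> B \<psi> p"
    by (rule inv_param_TC_restrict_le[OF assms B' F'])
  finally show "inv_TC G (subtopology E F) \<phi> \<le> inv_param_TC G E \<phi> B \<psi> p" .
qed

end
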